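(* Let $x,y$ be formal variables. In $\mathcal{A}[[x,y]]$, we have $$1+\sum_{k\ge r\ge1}S(k,r)\,x^{k-r}y^r=\exp\left\{\sum_{n\ge1}\frac{\zeta_{\mathcal{A}}^{(2)}(n)}{n}\left(x^n-(x-y)^n\right)\right\}.$$
   Context: Let $\mathcal{P}$ be the set of prime numbers and $\mathcal{A}=\prod_{p\in\mathcal{P}}\mathbb{Z}/p\mathbb{Z}\big/\bigoplus_{p\in\mathcal{P}}\mathbb{Z}/p\mathbb{Z}$, which is a $\mathbb{Q}$-algebra. For a finite sequence of positive integers $(k_1,\ldots,k_r)$, the level-two finite multiple zeta value is $$\zeta_{\mathcal{A}}^{(2)}(k_1,\ldots,k_r)=\left(\sum_{0<n_1<\cdots<n_r<p/2}\frac{1}{n_1^{k_1}\cdots n_r^{k_r}}\bmod p\right)_{p}\in\mathcal{A}.$$ For integers $k\ge r\ge1$, $$S(k,r)=\sum_{k_1+\cdots+k_r=k}\zeta_{\mathcal{A}}^{(2)}(k_1,\ldots,k_r),$$ the sum being over all $r$-tuples of positive integers with sum $k$. *)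

theory Defs
  imports
    "HOL-Number_Theory.Number_Theory"
    "HOL-Number_Theory.Modular_Inverse"
    "HOL-Computational_Algebra.Formal_Power_Series"
begin

section \<open>The product of all prime fields\<close>

text \<open>
  An element is represented by a family of integers indexed by \<^typ>\<open>nat\<close>; the values at
  non-prime indices are ignored, and the value at a prime \<open>p\<close> matters only modulo \<open>p\<close>.
\<close>
quotient_type prime_prod = "nat \<Rightarrow> int" /
  "\<lambda>f g. \<forall>p. prime p \<longrightarrow> [f p = g p] (mod int p)"
  by (intro equivpI reflpI sympI transpI) (auto intro: cong_sym cong_trans)

instantiation prime_prod :: comm_ring_1
begin

lift_definition zero_prime_prod :: prime_prod is "\<lambda>_. 0" .
lift_definition one_prime_prod :: prime_prod is "\<lambda>_. 1" .
lift_definition plus_prime_prod :: "prime_prod \<Rightarrow> prime_prod \<Rightarrow> prime_prod"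
  is "\<lambda>f g p. f p + g p" by (auto intro: cong_add)
lift_definition minus_prime_prod :: "prime_prod \<Rightarrow> prime_prod \<Rightarrow> prime_prod"
  is "\<lambda>f g p. f p - g p" by (auto intro: cong_diff)
lift_definition uminus_prime_prod :: "prime_prod \<Rightarrow> prime_prod"
  is "\<lambda>f p. - f p" by (auto simp: cong_minus_minus_iff)
lift_definition times_prime_prod :: "prime_prod \<Rightarrow> prime_prod \<Rightarrow> prime_prod"
  is "\<lambda>f g p. f p * g p" by (auto intro: cong_mult)

instance
proof
  show "(0 :: prime_prod) \<noteq> 1"
    by transfer (auto simp: cong_def intro!: exI[of _ 2])
qed (transfer; simp add: algebra_simps)+

end

text \<open>The coordinate at \<open>p\<close>, as the least non-negative residue; \<open>0\<close> at non-prime indices.\<close>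
lift_definition coord :: "prime_prod \<Rightarrow> nat \<Rightarrow> int"
  is "\<lambda>f p. if prime p then f p mod int p else 0"
  by (auto simp: cong_def)

lemma modular_inverse_cong:
  fixes a b :: int
  assumes "prime p" "[a = b] (mod int p)"
  shows "[modular_inverse (int p) a = modular_inverse (int p) b] (mod int p)"
proof (cases "coprime b (int p)")
  case True
  have "p > 0" using assms(1) by (rule prime_gt_0_nat)
  have "[a * modular_inverse (int p) b = b * modular_inverse (int p) b] (mod int p)"
    by (intro cong_mult assms cong_refl)
  also have "[b * modular_inverse (int p) b = 1] (mod int p)"
    by (rule cong_modular_inverse1[OF True])
  finally have "modular_inverse (int p) a = modular_inverse (int p) b"
    using \<open>p > 0\<close>
    by (intro modular_inverse_int_eqI)
       (auto simp: modular_inverse_int_nonneg modular_inverse_int_less)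
  then show ?thesis by simp
next
  case False
  then have "\<not> coprime a (int p)"
    using assms(2) by (metis cong_imp_coprime)
  then show ?thesis using False by simp
qed

text \<open>Componentwise inversion, with the usual convention that the inverse of \<open>0\<close> in
  $\mathbb{Z}/p\mathbb{Z}$ is \<open>0\<close>.\<close>
lift_definition inv_prime_prod :: "prime_prod \<Rightarrow> prime_prod"
  is "\<lambda>f p. modular_inverse (int p) (f p)"
  by (rule modular_inverse_cong)

definition direct_sum :: "prime_prod set" where
  "direct_sum = {x. finite {p. prime p \<and> coord x p \<noteq> 0}}"

lemma coord_abs: "coord (abs_prime_prod f) p = (if prime p then f p mod int p else 0)"
  by (simp add: coord.abs_eq)

lemma direct_sum_abs:
  "abs_prime_prod f \<in> direct_sum \<longleftrightarrow> finite {p. prime p \<and> \<not> [f p = 0] (mod int p)}"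
proof -
  have "{p. prime p \<and> coord (abs_prime_prod f) p \<noteq> 0} = {p. prime p \<and> \<not> [f p = 0] (mod int p)}"
    by (auto simp: coord_abs cong_def)
  then show ?thesis by (simp add: direct_sum_def)
qed

lemma prime_prod_cases: obtains f where "x = abs_prime_prod f"
  using that[of "rep_prime_prod x"] by (simp add: Quotient3_abs_rep[OF Quotient3_prime_prod])

lemma direct_sum_0: "0 \<in> direct_sum"
  by (simp add: zero_prime_prod_def direct_sum_abs)

lemma direct_sum_add: "x \<in> direct_sum \<Longrightarrow> y \<in> direct_sum \<Longrightarrow> x + y \<in> direct_sum"
proof (cases x rule: prime_prod_cases, cases y rule: prime_prod_cases)
  fix f g assume xy: "x = abs_prime_prod f" "y = abs_prime_prod g"
    and "x \<in> direct_sum" "y \<in> direct_sum"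
  then have "finite ({p. prime p \<and> \<not> [f p = 0] (mod int p)} \<union> {p. prime p \<and> \<not> [g p = 0] (mod int p)})"
    by (simp add: direct_sum_abs)
  moreover have "[f p + g p = 0] (mod int p)"
    if "[f p = 0] (mod int p)" "[g p = 0] (mod int p)" for p
    using cong_add[OF that] by simp
  then have "{p. prime p \<and> \<not> [f p + g p = 0] (mod int p)} \<subseteq>
      {p. prime p \<and> \<not> [f p = 0] (mod int p)} \<union> {p. prime p \<and> \<not> [g p = 0] (mod int p)}"
    by blast
  ultimately show ?thesis
    unfolding xy plus_prime_prod.abs_eq direct_sum_abs by (rule rev_finite_subset)
qed

lemma direct_sum_mult: "x \<in> direct_sum \<Longrightarrow> y * x \<in> direct_sum"
proof (cases x rule: prime_prod_cases, cases y rule: prime_prod_cases)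
  fix f g assume xy: "x = abs_prime_prod f" "y = abs_prime_prod g" and "x \<in> direct_sum"
  then have "finite {p. prime p \<and> \<not> [f p = 0] (mod int p)}"
    by (simp add: direct_sum_abs)
  moreover have "[g p * f p = 0] (mod int p)" if "[f p = 0] (mod int p)" for p
    using cong_mult[OF cong_refl that] by simp
  then have "{p. prime p \<and> \<not> [g p * f p = 0] (mod int p)} \<subseteq> {p. prime p \<and> \<not> [f p = 0] (mod int p)}"
    by blast
  ultimately show ?thesis
    unfolding xy times_prime_prod.abs_eq direct_sum_abs by (rule rev_finite_subset)
qed

lemma direct_sum_uminus: "x \<in> direct_sum \<Longrightarrow> - x \<in> direct_sum"
  using direct_sum_mult[of x "-1"] by simp

lemma direct_sum_diff: "x \<in> direct_sum \<Longrightarrow> y \<in> direct_sum \<Longrightarrow> x - y \<in> direct_sum"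
  using direct_sum_add[of x "- y"] direct_sum_uminus[of y] by simp


section \<open>The ring $\mathcal{A}$\<close>

quotient_type ringA = prime_prod / "\<lambda>x y. x - y \<in> direct_sum"
proof (intro equivpI reflpI sympI transpI)
  fix x y z :: prime_prod
  show "x - x \<in> direct_sum" by (simp add: direct_sum_0)
  show "y - x \<in> direct_sum" if "x - y \<in> direct_sum"
    using direct_sum_uminus[OF that] by simp
  show "x - z \<in> direct_sum" if "x - y \<in> direct_sum" "y - z \<in> direct_sum"
    using direct_sum_add[OF that] by simp
qed

instantiation ringA :: comm_ring_1
begin

lift_definition zero_ringA :: ringA is 0 .
lift_definition one_ringA :: ringA is 1 .
lift_definition plus_ringA :: "ringA \<Rightarrow> ringA \<Rightarrow> ringA" is "(+)"
  by (metis add_diff_add direct_sum_add)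
lift_definition minus_ringA :: "ringA \<Rightarrow> ringA \<Rightarrow> ringA" is "(-)"
proof -
  fix x x' y y' :: prime_prod
  assume "x - x' \<in> direct_sum" "y - y' \<in> direct_sum"
  then have "(x - x') - (y - y') \<in> direct_sum" by (rule direct_sum_diff)
  then show "(x - y) - (x' - y') \<in> direct_sum" by (simp add: algebra_simps)
qed
lift_definition uminus_ringA :: "ringA \<Rightarrow> ringA" is uminus
  using direct_sum_uminus by fastforce
lift_definition times_ringA :: "ringA \<Rightarrow> ringA \<Rightarrow> ringA" is "(*)"
proof -
  fix x x' y y' :: prime_prod
  assume "x - x' \<in> direct_sum" "y - y' \<in> direct_sum"
  then have "y * (x - x') + x' * (y - y') \<in> direct_sum"
    by (intro direct_sum_add direct_sum_mult)
  then show "x * y - x' * y' \<in> direct_sum" by (simp add: algebra_simps)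
qed

instance
proof
  have "{p::nat. prime p \<and> \<not> [- 1 = 0] (mod int p)} = {p. prime p}"
    by (auto simp: cong_def zmod_zminus1_eq_if dest: prime_gt_1_nat)
  then have "0 - 1 \<notin> direct_sum"
    by (simp add: zero_prime_prod_def one_prime_prod_def minus_prime_prod.abs_eq
          direct_sum_abs uminus_prime_prod.abs_eq primes_infinite)
  then show "(0 :: ringA) \<noteq> 1" by transfer
qed (transfer; simp add: algebra_simps direct_sum_0)+

end

text \<open>The class $(a_p \bmod p)_p$ of a family of integers.\<close>
definition of_family :: "(nat \<Rightarrow> int) \<Rightarrow> ringA" where
  "of_family a = abs_ringA (abs_prime_prod a)"

lemma of_family_eq_iff:
  "of_family a = of_family b \<longleftrightarrow> finite {p. prime p \<and> \<not> [a p = b p] (mod int p)}"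
  by (simp add: of_family_def ringA.abs_eq_iff minus_prime_prod.abs_eq direct_sum_abs
        cong_iff_dvd_diff)

lemma of_family_cases: obtains a where "x = of_family a"
proof -
  obtain a where "rep_ringA x = abs_prime_prod a" by (rule prime_prod_cases)
  then have "x = of_family a"
    using Quotient3_abs_rep[OF Quotient3_ringA, of x] by (simp add: of_family_def)
  then show thesis by (rule that)
qed

lemma of_family_ring_ops:
  "of_family (\<lambda>_. 0) = 0" "of_family (\<lambda>_. 1) = 1"
  "of_family (\<lambda>p. a p + b p) = of_family a + of_family b"
  "of_family (\<lambda>p. a p - b p) = of_family a - of_family b"
  "of_family (\<lambda>p. - a p) = - of_family a"
  "of_family (\<lambda>p. a p * b p) = of_family a * of_family b"
  by (simp_all add: of_family_def zero_ringA_def one_ringA_def zero_prime_prod_def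
        one_prime_prod_def plus_ringA.abs_eq minus_ringA.abs_eq uminus_ringA.abs_eq
        times_ringA.abs_eq plus_prime_prod.abs_eq minus_prime_prod.abs_eq
        uminus_prime_prod.abs_eq times_prime_prod.abs_eq)

lemma of_family_of_nat: "of_family (\<lambda>_. int n) = of_nat n"
  by (induction n) (simp_all add: of_family_ring_ops(1,2,3))

text \<open>
  Componentwise inversion descends to the quotient. It agrees with inversion on the units
  (\<open>inverse_ringA_unique\<close>). Every positive integer is a unit (\<open>ringA_Rat_algebra\<close>),
  and this is what makes the ring a $\mathbb{Q}$-algebra.
\<close>
instantiation ringA :: inverse
begin

lift_definition inverse_ringA :: "ringA \<Rightarrow> ringA" is inv_prime_prod
proof -
  fix x y :: prime_prod
  assume "x - y \<in> direct_sum"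
  obtain f where x: "x = abs_prime_prod f" by (rule prime_prod_cases)
  obtain g where y: "y = abs_prime_prod g" by (rule prime_prod_cases)
  note xy = x y
  let ?i = "\<lambda>f p. modular_inverse (int p) (f p :: int)"
  have "finite {p. prime p \<and> \<not> [f p = g p] (mod int p)}"
    using \<open>x - y \<in> direct_sum\<close>
    by (simp add: xy minus_prime_prod.abs_eq direct_sum_abs cong_iff_dvd_diff)
  then have "finite {p. prime p \<and> \<not> [?i f p = ?i g p] (mod int p)}"
    by (rule rev_finite_subset) (use modular_inverse_cong in blast)
  then show "inv_prime_prod x - inv_prime_prod y \<in> direct_sum"
    by (simp add: xy inv_prime_prod.abs_eq minus_prime_prod.abs_eq direct_sum_abs
          cong_iff_dvd_diff)
qed

definition divide_ringA :: "ringA \<Rightarrow> ringA \<Rightarrow> ringA" where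
  "divide_ringA x y = x * inverse y"

instance ..

end

lemma inverse_of_family:
  "inverse (of_family a) = of_family (\<lambda>p. modular_inverse (int p) (a p))"
  by (simp add: of_family_def inverse_ringA.abs_eq inv_prime_prod.abs_eq)

lemma inverse_ringA_unique:
  fixes x y :: ringA
  assumes "x * y = 1"
  shows "inverse x = y"
proof -
  obtain a where x: "x = of_family a" by (rule of_family_cases)
  obtain b where y: "y = of_family b" by (rule of_family_cases)
  note xy = x y
  have "of_family (\<lambda>p. a p * b p) = of_family (\<lambda>_. 1)"
    using assms by (simp only: xy of_family_ring_ops(2,6))
  then have fin: "finite {p. prime p \<and> \<not> [a p * b p = 1] (mod int p)}"
    by (simp only: of_family_eq_iff)
  have "[modular_inverse (int p) (a p) = b p] (mod int p)"
    if "prime p" "[a p * b p = 1] (mod int p)" for p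
  proof -
    have "p > 0" using that(1) by (rule prime_gt_0_nat)
    moreover have "[a p * (b p mod int p) = 1] (mod int p)"
      using that(2) by (simp add: cong_def mod_mult_right_eq)
    ultimately have "modular_inverse (int p) (a p) = b p mod int p"
      by (intro modular_inverse_int_eqI) auto
    then show ?thesis by (simp add: cong_def)
  qed
  then have "{p. prime p \<and> \<not> [modular_inverse (int p) (a p) = b p] (mod int p)}
      \<subseteq> {p. prime p \<and> \<not> [a p * b p = 1] (mod int p)}" by blast
  then show ?thesis
    unfolding xy inverse_of_family of_family_eq_iff using fin by (rule finite_subset)
qed

lemma ringA_Rat_algebra:
  assumes "n > 0"
  shows "of_nat n * inverse (of_nat n :: ringA) = 1"
proof -
  have "[int n * modular_inverse (int p) (int n) = 1] (mod int p)" if "prime p" "p > n" for p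
  proof (rule cong_modular_inverse1)
    have "\<not> p dvd n" using that assms by (auto dest: dvd_imp_le)
    then show "coprime (int n) (int p)"
      using that prime_imp_coprime[of p n] by (simp add: coprime_commute)
  qed
  then have "{p. prime p \<and> \<not> [int n * modular_inverse (int p) (int n) = 1] (mod int p)} \<subseteq> {..n}"
    using leI by blast
  then have "finite {p. prime p \<and> \<not> [int n * modular_inverse (int p) (int n) = 1] (mod int p)}"
    by (rule finite_subset) simp
  then have "of_family (\<lambda>p. int n * modular_inverse (int p) (int n)) = of_family (\<lambda>_. 1)"
    by (simp only: of_family_eq_iff)
  then show ?thesis
    by (simp only: of_family_ring_ops inverse_of_family[symmetric] of_family_of_nat)
qed


section \<open>Level-two finite multiple zeta values\<close>

definition index_tuples :: "nat \<Rightarrow> nat \<Rightarrow> nat list set" where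
  "index_tuples p r =
     {ns. length ns = r \<and> sorted_wrt (<) ns \<and> (\<forall>n\<in>set ns. 0 < n \<and> real n < real p / 2)}"

definition zeta2 :: "nat list \<Rightarrow> ringA" where
  "zeta2 ks = of_family (\<lambda>p. \<Sum>ns\<in>index_tuples p (length ks).
     modular_inverse (int p) (\<Prod>i<length ks. int (ns ! i) ^ (ks ! i)))"

definition compositions :: "nat \<Rightarrow> nat \<Rightarrow> nat list set" where
  "compositions k r = {ks. length ks = r \<and> (\<forall>a\<in>set ks. 0 < a) \<and> sum_list ks = k}"

definition S :: "nat \<Rightarrow> nat \<Rightarrow> ringA" where
  "S k r = (\<Sum>ks\<in>compositions k r. zeta2 ks)"

lemma finite_index_tuples: "finite (index_tuples p r)"
proof (rule finite_subset)
  show "index_tuples p r \<subseteq> {ns. set ns \<subseteq> {..p} \<and> length ns = r}"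
    by (force simp: index_tuples_def)
qed (simp add: finite_lists_length_eq)

lemma finite_compositions: "finite (compositions k r)"
proof (rule finite_subset)
  show "compositions k r \<subseteq> {ks. set ks \<subseteq> {..k} \<and> length ks = r}"
    by (auto simp: compositions_def dest: member_le_sum_list)
qed (simp add: finite_lists_length_eq)


section \<open>Power series in two variables\<close>

unbundle fps_syntax

text \<open>
  $R[[x,y]]$ is rendered as $R[[x]][[y]]$: the coefficient of $x^i y^j$ in \<open>F\<close> is
  \<open>F $ j $ i\<close>. The library's metric on \<open>'a fps fps\<close> is the $y$-adic one, for which the
  infinite sums below need not converge; \<open>formal_sum\<close> is the coefficientwise sum, and is
  meaningful for families satisfying \<open>formally_summable\<close>.
\<close>
type_synonym 'a fps2 = "'a fps fps"

definition const2 :: "'a::zero \<Rightarrow> 'a fps2" where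
  "const2 c = fps_const (fps_const c)"

definition var_x :: "'a::{zero,one} fps2" where
  "var_x = fps_const fps_X"

definition var_y :: "'a::{zero,one} fps2" where
  "var_y = fps_X"

definition formally_summable :: "('i \<Rightarrow> 'a::comm_monoid_add fps2) \<Rightarrow> 'i set \<Rightarrow> bool" where
  "formally_summable f I \<longleftrightarrow> (\<forall>i j. finite {n\<in>I. f n $ j $ i \<noteq> 0})"

definition formal_sum :: "('i \<Rightarrow> 'a::comm_monoid_add fps2) \<Rightarrow> 'i set \<Rightarrow> 'a fps2" where
  "formal_sum f I = Abs_fps (\<lambda>j. Abs_fps (\<lambda>i. \<Sum>n\<in>{n\<in>I. f n $ j $ i \<noteq> 0}. f n $ j $ i))"

text \<open>\<open>F\<close> is expected to have constant coefficient \<open>0\<close> (see \<open>formally_summable_exp\<close>).\<close>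
definition formal_exp :: "'a::{comm_ring_1,inverse} fps2 \<Rightarrow> 'a fps2" where
  "formal_exp F = formal_sum (\<lambda>n. const2 (inverse (of_nat (fact n))) * F ^ n) UNIV"


text \<open>The three families to which \<^const>\<open>formal_sum\<close> gets applied are summable.\<close>

definition order_ge :: "nat \<Rightarrow> 'a::zero fps2 \<Rightarrow> bool" where
  "order_ge d F \<longleftrightarrow> (\<forall>i j. i + j < d \<longrightarrow> F $ j $ i = 0)"

lemma order_ge_mult:
  fixes F G :: "'a::comm_ring_1 fps2"
  assumes "order_ge d F" "order_ge e G"
  shows "order_ge (d + e) (F * G)"
  unfolding order_ge_def
proof (intro allI impI)
  fix i j assume "i + j < d + e"
  have "F $ a $ b * G $ (j - a) $ (i - b) = 0" if "a \<le> j" "b \<le> i" for a b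
  proof (cases "b + a < d")
    case True
    then show ?thesis using assms(1) by (simp add: order_ge_def)
  next
    case False
    then have "(i - b) + (j - a) < e" using that \<open>i + j < d + e\<close> by linarith
    then show ?thesis using assms(2) by (simp add: order_ge_def)
  qed
  then show "(F * G) $ j $ i = 0"
    by (simp add: fps_mult_nth fps_sum_nth)
qed

lemma order_ge_0: "order_ge 0 F"
  by (simp add: order_ge_def)

lemma order_ge_power:
  fixes F :: "'a::comm_ring_1 fps2"
  assumes "order_ge 1 F"
  shows "order_ge n (F ^ n)"
proof (induction n)
  case (Suc n)
  then show ?case using order_ge_mult[OF assms Suc] by simp
qed (simp add: order_ge_0)

lemma order_ge_diff:
  fixes F G :: "'a::comm_ring_1 fps2"
  shows "order_ge d F \<Longrightarrow> order_ge d G \<Longrightarrow> order_ge d (F - G)"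
  by (simp add: order_ge_def)

lemma order_ge_var_x: "order_ge 1 (var_x :: 'a::comm_ring_1 fps2)"
  by (simp add: order_ge_def var_x_def)

lemma order_ge_var_y: "order_ge 1 (var_y :: 'a::comm_ring_1 fps2)"
  by (simp add: order_ge_def var_y_def)

lemma formally_summable_order:
  assumes "\<And>n. n \<in> I \<Longrightarrow> order_ge (d n) (f n)" "\<And>m. finite {n\<in>I. d n \<le> m}"
  shows "formally_summable f I"
  unfolding formally_summable_def
proof (intro allI)
  fix i j
  have "{n\<in>I. f n $ j $ i \<noteq> 0} \<subseteq> {n\<in>I. d n \<le> i + j}"
    using assms(1) by (force simp: order_ge_def not_less[symmetric])
  then show "finite {n\<in>I. f n $ j $ i \<noteq> 0}"
    using assms(2) by (rule finite_subset)
qed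

lemma formally_summable_exp:
  fixes F :: "'a::{comm_ring_1,inverse} fps2"
  assumes "F $ 0 $ 0 = 0"
  shows "formally_summable (\<lambda>n. const2 (inverse (of_nat (fact n))) * F ^ n) UNIV"
proof (rule formally_summable_order[where d = id])
  have "order_ge 1 F" using assms by (simp add: order_ge_def)
  then show "order_ge (id n) (const2 (inverse (of_nat (fact n))) * F ^ n)" for n
    using order_ge_mult[OF order_ge_0 order_ge_power] by fastforce
qed simp

lemma formally_summable_S:
  "formally_summable (\<lambda>(k, r). const2 (S k r) * var_x ^ (k - r) * var_y ^ r)
     {(k, r). k \<ge> r \<and> r \<ge> 1}"
proof (rule formally_summable_order[where d = fst])
  fix kr :: "nat \<times> nat" assume "kr \<in> {(k, r). k \<ge> r \<and> r \<ge> 1}"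
  then obtain k r where kr: "kr = (k, r)" "r \<le> k" by auto
  have "order_ge (0 + (k - r) + r) (const2 (S k r) * var_x ^ (k - r) * var_y ^ r)"
    by (intro order_ge_mult order_ge_0 order_ge_power order_ge_var_x order_ge_var_y)
  then show "order_ge (fst kr) (case kr of (k, r) \<Rightarrow> const2 (S k r) * var_x ^ (k - r) * var_y ^ r)"
    using kr by simp
next
  fix m :: nat
  show "finite {n \<in> {(k, r). k \<ge> r \<and> r \<ge> (1::nat)}. fst n \<le> m}"
    by (rule finite_subset[of _ "{..m} \<times> {..m}"]) auto
qed

lemma order_ge_zeta2_term:
  "order_ge n (const2 (zeta2 [n] / of_nat n) * (var_x ^ n - (var_x - var_y) ^ n))"
proof -
  have "order_ge (0 + n) (const2 (zeta2 [n] / of_nat n) * (var_x ^ n - (var_x - var_y) ^ n))"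
    by (intro order_ge_mult order_ge_0 order_ge_diff order_ge_power order_ge_var_x order_ge_var_y)
  then show ?thesis by simp
qed

lemma formally_summable_zeta2:
  "formally_summable (\<lambda>n. const2 (zeta2 [n] / of_nat n) * (var_x ^ n - (var_x - var_y) ^ n)) {1..}"
proof (rule formally_summable_order[where d = id])
  show "finite {n \<in> {1..}. id n \<le> m}" for m :: nat
    by (rule finite_subset[of _ "{..m}"]) auto
qed (simp add: order_ge_zeta2_term)

lemma formal_sum_zeta2_const:
  "formal_sum (\<lambda>n. const2 (zeta2 [n] / of_nat n) * (var_x ^ n - (var_x - var_y) ^ n)) {1..} $ 0 $ 0 = 0"
proof -
  have "(const2 (zeta2 [n] / of_nat n) * (var_x ^ n - (var_x - var_y) ^ n)) $ 0 $ 0 = 0"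
    if "n \<in> {1..}" for n
    using order_ge_zeta2_term[unfolded order_ge_def, rule_format, of 0 0 n] that by simp
  then show ?thesis
    unfolding formal_sum_def fps_nth_Abs_fps by (intro sum.neutral) blast
qed

end

theory Submission
  imports Defs
begin

text \<open>
  For a fixed prime $p$ write $a_n$ for the inverse of $n$ modulo $p$. Summing over all exponents at
  once, a tuple $n_1<\cdots<n_r$ contributes $\prod_i y\,a_{n_i}/(1-a_{n_i}x)$ to the left-hand side, so
  that side is the finite product
  $$G=\prod_{0<n<p/2}\Bigl(1+\frac{y\,a_n}{1-a_nx}\Bigr)
     =\prod_{0<n<p/2}\frac{1-a_n(x-y)}{1-a_nx},$$
  and the theorem is the expansion of its logarithm in power sums of the $a_n$.

  The logarithm has denominators, which are units modulo $p$ only for $p$ large compared with the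
  degree. The proof therefore replaces it by the logarithmic derivative in $y$, which has none:
  $$\partial_yG=\Bigl(\sum_{m\ge1}\Bigl(\sum_n a_n^m\Bigr)(x-y)^{m-1}\Bigr)\,G.$$
  This holds for arbitrary elements $a_n$ of a commutative ring (\<open>fps_deriv_gen_series\<close>). For
  integers $a_n$ that represent the inverses modulo $p$, each of its coefficients is a finite integer
  identity for every $p$, so that it carries over to $\mathcal{A}$, where the power sums become
  $\zeta_{\mathcal{A}}^{(2)}(m)$ (\<open>S_recurrence\<close>, \<open>fps_deriv_S_series\<close>).

  On the right-hand side, the exponent $F$ has
  $\partial_yF=\sum_{m\ge1}\zeta_{\mathcal{A}}^{(2)}(m)(x-y)^{m-1}$ (\<open>fps_deriv_exponent\<close>), whence
  $\exp F$ satisfies the same linear differential equation (\<open>fps_deriv_formal_exp\<close>). Both sides are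
  $1$ at $y=0$, and over a $\mathbb{Q}$-algebra such an equation has only one solution with given
  value there (\<open>fps2_ode_unique\<close>).
\<close>

section \<open>Sums over increasing tuples and compositions\<close>

definition increasing_tuples :: "nat \<Rightarrow> nat \<Rightarrow> nat list set" where
  "increasing_tuples N r = {ns. length ns = r \<and> sorted_wrt (<) ns \<and> set ns \<subseteq> {0<..N}}"

lemma finite_increasing_tuples: "finite (increasing_tuples N r)"
  by (rule finite_subset[OF _ finite_lists_length_eq[of "{0<..N}" r]]) (auto simp: increasing_tuples_def)

lemma increasing_tuples_0_right: "increasing_tuples N 0 = {[]}"
  by (auto simp: increasing_tuples_def)

lemma increasing_tuples_0_left: "increasing_tuples 0 (Suc r) = {}"
  by (auto simp: increasing_tuples_def)

lemma increasing_tuples_Suc: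
  "increasing_tuples (Suc N) (Suc r)
     = increasing_tuples N (Suc r) \<union> (\<lambda>ns. ns @ [Suc N]) ` increasing_tuples N r"
    (is "?L = ?R")
proof
  show "?L \<subseteq> ?R"
  proof
    fix ns assume ns: "ns \<in> ?L"
    then obtain ms m where nsm: "ns = ms @ [m]"
      by (cases ns rule: rev_cases) (auto simp: increasing_tuples_def)
    show "ns \<in> ?R"
    proof (cases "m = Suc N")
      case True
      then have "ms \<in> increasing_tuples N r" using ns nsm
        by (fastforce simp: increasing_tuples_def sorted_wrt_append)
      then show ?thesis using nsm True by auto
    next
      case False
      then have "m \<le> N" using ns nsm by (auto simp: increasing_tuples_def)
      then have "ns \<in> increasing_tuples N (Suc r)" using ns nsm
        by (fastforce simp: increasing_tuples_def sorted_wrt_append)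
      then show ?thesis by blast
    qed
  qed
  show "?R \<subseteq> ?L"
    by (fastforce simp: increasing_tuples_def sorted_wrt_append)
qed

lemma compositions_0_right: "compositions k 0 = (if k = 0 then {[]} else {})"
  by (auto simp: compositions_def)

lemma compositions_empty: "k < r \<Longrightarrow> compositions k r = {}"
proof -
  have "length ks \<le> sum_list ks" if "\<forall>a\<in>set ks. 0 < a" for ks :: "nat list"
    using that by (induction ks) auto
  then show "k < r \<Longrightarrow> compositions k r = {}"
    by (fastforce simp: compositions_def)
qed

text \<open>
  Splitting off the last part, not the first, matches the induction on the upper bound \<open>N\<close>,
  which removes the largest entry of an increasing tuple.
\<close>
lemma sum_compositions_Suc:
  fixes f :: "nat list \<Rightarrow> 'a::comm_monoid_add"
  shows "(\<Sum>ks\<in>compositions k (Suc r). f ks)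
       = (\<Sum>c=1..k. \<Sum>ks\<in>compositions (k - c) r. f (ks @ [c]))"
proof -
  have "bij_betw (\<lambda>(c, ks). ks @ [c]) (SIGMA c:{1..k}. compositions (k - c) r)
          (compositions k (Suc r))"
    unfolding bij_betw_def
  proof
    show "inj_on (\<lambda>(c, ks). ks @ [c]) (SIGMA c:{1..k}. compositions (k - c) r)"
      by (auto simp: inj_on_def)
    show "(\<lambda>(c, ks). ks @ [c]) ` (SIGMA c:{1..k}. compositions (k - c) r) = compositions k (Suc r)"
    proof
      show "compositions k (Suc r) \<subseteq> (\<lambda>(c, ks). ks @ [c]) ` (SIGMA c:{1..k}. compositions (k - c) r)"
      proof
        fix ks assume ks: "ks \<in> compositions k (Suc r)"
        then obtain ls c where "ks = ls @ [c]"
          by (cases ks rule: rev_cases) (auto simp: compositions_def)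
        with ks show "ks \<in> (\<lambda>(c, ks). ks @ [c]) ` (SIGMA c:{1..k}. compositions (k - c) r)"
          by (intro image_eqI[of _ _ "(c, ls)"]) (auto simp: compositions_def)
      qed
    qed (auto simp: compositions_def)
  qed
  from sum.reindex_bij_betw[OF this, of f] show ?thesis
    by (subst sum.Sigma) (auto simp: finite_compositions case_prod_unfold)
qed

text \<open>
  This is $S(k,r)$ with the reciprocals $1/n$ replaced by arbitrary ring elements \<open>a n\<close>, so that
  the identities below hold exactly and can be specialised to residues modulo any prime.
\<close>
definition comp_sum :: "(nat \<Rightarrow> 'a::comm_ring_1) \<Rightarrow> nat \<Rightarrow> nat \<Rightarrow> nat \<Rightarrow> 'a" where
  "comp_sum a N k r =
     (\<Sum>ks\<in>compositions k r. \<Sum>ns\<in>increasing_tuples N r. \<Prod>i<r. a (ns ! i) ^ (ks ! i))"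

lemma comp_sum_0_right: "comp_sum a N k 0 = (if k = 0 then 1 else 0)"
  by (simp add: comp_sum_def compositions_0_right increasing_tuples_0_right)

lemma comp_sum_0_left: "comp_sum a 0 k (Suc r) = 0"
  by (simp add: comp_sum_def increasing_tuples_0_left)

lemma comp_sum_eq_0: "k < r \<Longrightarrow> comp_sum a N k r = 0"
  by (simp add: comp_sum_def compositions_empty)

text \<open>
  Either the largest entry of the increasing tuple is at most \<open>N\<close>, or it is \<open>Suc N\<close> and carries
  the last exponent \<open>c\<close>. On generating functions this is multiplication by one further factor
  (\<open>gen_series_Suc\<close>).
\<close>
lemma comp_sum_Suc:
  "comp_sum a (Suc N) k (Suc r)
     = comp_sum a N k (Suc r) + (\<Sum>c=1..k. a (Suc N) ^ c * comp_sum a N (k - c) r)"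
proof -
  let ?t = "\<lambda>r ns ks. \<Prod>i<r. a (ns ! i) ^ (ks ! i)"
  have inj: "inj_on (\<lambda>ns. ns @ [Suc N]) (increasing_tuples N r)"
    by (auto simp: inj_on_def)
  have disj: "increasing_tuples N (Suc r) \<inter> (\<lambda>ns. ns @ [Suc N]) ` increasing_tuples N r = {}"
    by (auto simp: increasing_tuples_def)
  have "comp_sum a (Suc N) k (Suc r) =
      (\<Sum>ks\<in>compositions k (Suc r). (\<Sum>ns\<in>increasing_tuples N (Suc r). ?t (Suc r) ns ks)
         + (\<Sum>ns\<in>increasing_tuples N r. ?t (Suc r) (ns @ [Suc N]) ks))"
    unfolding comp_sum_def increasing_tuples_Suc
    by (intro sum.cong refl, subst sum.union_disjoint)
       (simp_all add: finite_increasing_tuples disj sum.reindex[OF inj] del: prod.lessThan_Suc)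
  also have "\<dots> = comp_sum a N k (Suc r) +
      (\<Sum>ks\<in>compositions k (Suc r). \<Sum>ns\<in>increasing_tuples N r. ?t (Suc r) (ns @ [Suc N]) ks)"
    by (simp only: sum.distrib comp_sum_def)
  also have "(\<Sum>ks\<in>compositions k (Suc r). \<Sum>ns\<in>increasing_tuples N r. ?t (Suc r) (ns @ [Suc N]) ks)
      = (\<Sum>c=1..k. \<Sum>ks\<in>compositions (k - c) r. \<Sum>ns\<in>increasing_tuples N r.
           ?t (Suc r) (ns @ [Suc N]) (ks @ [c]))"
    by (rule sum_compositions_Suc)
  also have "\<dots> = (\<Sum>c=1..k. \<Sum>ks\<in>compositions (k - c) r. \<Sum>ns\<in>increasing_tuples N r.
           a (Suc N) ^ c * ?t r ns ks)"
  proof (intro sum.cong refl)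
    fix c ks ns assume "ks \<in> compositions (k - c) r" "ns \<in> increasing_tuples N r"
    then have [simp]: "length ks = r" "length ns = r"
      by (simp_all add: compositions_def increasing_tuples_def)
    show "?t (Suc r) (ns @ [Suc N]) (ks @ [c]) = a (Suc N) ^ c * ?t r ns ks"
      by (simp add: nth_append mult.commute)
  qed
  also have "\<dots> = (\<Sum>c=1..k. a (Suc N) ^ c * comp_sum a N (k - c) r)"
    by (simp only: comp_sum_def sum_distrib_left)
  finally show ?thesis .
qed

section \<open>The generating function over a commutative ring\<close>

text \<open>The series $a/(1-ax)$.\<close>
definition geometric :: "'a::comm_ring_1 \<Rightarrow> 'a fps" where
  "geometric a = Abs_fps (\<lambda>i. a ^ Suc i)"

text \<open>
  The negative binomial series; the induction step is the hockey-stick identity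
  $\sum_{d\le c}\binom{b+d}{b}=\binom{b+c+1}{b+1}$.
\<close>
lemma geometric_power_nth:
  "(geometric a ^ Suc b) $ c = of_nat ((b + c) choose b) * a ^ Suc (b + c)"
proof (induction b arbitrary: c)
  case 0
  then show ?case by (simp add: geometric_def)
next
  case (Suc b)
  have "(geometric a ^ Suc (Suc b)) $ c = (geometric a ^ Suc b * geometric a) $ c"
    by (simp add: mult.commute)
  also have "\<dots> = (\<Sum>d=0..c. of_nat ((b + d) choose b) * a ^ Suc (b + d) * a ^ Suc (c - d))"
    by (simp only: fps_mult_nth Suc) (simp only: geometric_def fps_nth_Abs_fps)
  also have "\<dots> = (\<Sum>d\<le>c. of_nat ((b + d) choose b)) * a ^ Suc (Suc b + c)"
    unfolding sum_distrib_right atLeast0AtMost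
  proof (intro sum.cong refl)
    fix d assume "d \<in> {..c}"
    then have "Suc (Suc b + c) = Suc (b + d) + Suc (c - d)" by simp
    then have "a ^ Suc (Suc b + c) = a ^ Suc (b + d) * a ^ Suc (c - d)"
      by (simp only: power_add)
    then show "of_nat ((b + d) choose b) * a ^ Suc (b + d) * a ^ Suc (c - d)
        = of_nat ((b + d) choose b) * a ^ Suc (Suc b + c)"
      by (simp only: mult.assoc)
  qed
  also have "(\<Sum>d\<le>c. of_nat ((b + d) choose b)) = (of_nat ((Suc b + c) choose Suc b) :: 'a)"
    using choose_rising_sum(1)[of b c] by (simp only: of_nat_sum[symmetric]) simp
  finally show ?case .
qed

text \<open>
  The series $a/(1-a(x-y))$, expanded in powers of $y$. It is the logarithmic derivative with
  respect to $y$ of $1+ya/(1-ax)=(1-a(x-y))/(1-ax)$, which \<open>log_deriv_factor_mult\<close> states as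
  a product, the derivative of $1+ya/(1-ax)$ being $a/(1-ax)$.
\<close>
definition log_deriv_factor :: "'a::comm_ring_1 \<Rightarrow> 'a fps2" where
  "log_deriv_factor a = Abs_fps (\<lambda>b. fps_const ((-1) ^ b) * geometric a ^ Suc b)"

lemma log_deriv_factor_nth:
  "log_deriv_factor a $ b $ c
     = (-1) ^ b * of_nat ((b + c) choose b) * a ^ Suc (b + c)"
  by (simp add: log_deriv_factor_def geometric_power_nth del: power_Suc)

lemma log_deriv_factor_mult:
  "log_deriv_factor a * (1 + fps_X * fps_const (geometric a))
     = fps_const (geometric a)"
proof (rule fps_ext)
  fix b
  have "(log_deriv_factor a * (1 + fps_X * fps_const (geometric a))) $ b
      = (log_deriv_factor a + fps_X * (log_deriv_factor a * fps_const (geometric a))) $ b"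
    by (simp add: algebra_simps)
  also have "\<dots> = fps_const (geometric a) $ b"
  proof (cases b)
    case (Suc d)
    \<comment> \<open>Consecutive coefficients $\pm g^{d+2}$, with $g=a/(1-ax)$, cancel.\<close>
    have "fps_const ((-1) ^ Suc d) = - fps_const ((-1::'a) ^ d)"
      by simp
    then show ?thesis using Suc
      by (simp add: log_deriv_factor_def algebra_simps del: fps_const_neg)
  qed (simp add: log_deriv_factor_def)
  finally show "(log_deriv_factor a * (1 + fps_X * fps_const (geometric a))) $ b
      = fps_const (geometric a) $ b" .
qed

text \<open>
  As \<open>gen_series_0\<close> and \<open>gen_series_Suc\<close> show, this is
  $\prod_{n\le N}\bigl(1+y\,a_n/(1-a_nx)\bigr)$.
\<close>
definition gen_series :: "(nat \<Rightarrow> 'a::comm_ring_1) \<Rightarrow> nat \<Rightarrow> 'a fps2" where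
  "gen_series a N = Abs_fps (\<lambda>j. Abs_fps (\<lambda>i. comp_sum a N (i + j) j))"

lemma gen_series_0: "gen_series a 0 = 1"
proof (intro fps_ext)
  fix j i
  show "gen_series a 0 $ j $ i = 1 $ j $ i"
    by (cases j) (auto simp: gen_series_def comp_sum_0_right comp_sum_0_left)
qed

lemma gen_series_Suc:
  "gen_series a (Suc N)
     = gen_series a N * (1 + fps_X * fps_const (geometric (a (Suc N))))"
proof (intro fps_ext)
  fix j i
  let ?g = "geometric (a (Suc N))"
  have R: "gen_series a N * (1 + fps_X * fps_const ?g)
      = gen_series a N + fps_X * (fps_const ?g * gen_series a N)"
    by (simp add: algebra_simps)
  show "gen_series a (Suc N) $ j $ i = (gen_series a N * (1 + fps_X * fps_const ?g)) $ j $ i"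
  proof (cases j)
    case 0
    then show ?thesis unfolding R by (simp add: gen_series_def comp_sum_0_right)
  next
    case (Suc r)
    let ?t = "\<lambda>c. a (Suc N) ^ Suc c * comp_sum a N (i + r - c) r"
    have "(\<Sum>c=1..i + Suc r. a (Suc N) ^ c * comp_sum a N (i + Suc r - c) r) = (\<Sum>c=0..i + r. ?t c)"
      using sum.shift_bounds_cl_Suc_ivl[of "\<lambda>c. a (Suc N) ^ c * comp_sum a N (i + Suc r - c) r" 0 "i + r"]
      by simp
    \<comment> \<open>For \<open>c > i\<close> fewer than \<open>r\<close> remains to be split into \<open>r\<close> positive parts.\<close>
    also have "\<dots> = (\<Sum>c=0..i. ?t c)"
      by (rule sum.mono_neutral_right) (auto simp: comp_sum_eq_0)
    also have "\<dots> = (\<Sum>c=0..i. a (Suc N) ^ Suc c * comp_sum a N (i - c + r) r)"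
      by (intro sum.cong refl) simp
    also have "\<dots> = (?g * gen_series a N $ r) $ i"
      unfolding fps_mult_nth by (simp only: geometric_def gen_series_def fps_nth_Abs_fps)
    finally show ?thesis
      unfolding R fps_add_nth fps_X_mult_nth fps_mult_left_const_nth Suc
      by (simp add: gen_series_def comp_sum_Suc del: One_nat_def sum.cl_ivl_Suc)
  qed
qed

lemma fps_deriv_gen_series:
  "fps_deriv (gen_series a N)
     = (\<Sum>n=1..N. log_deriv_factor (a n)) * gen_series a N"
proof (induction N)
  case 0
  then show ?case by (simp add: gen_series_0)
next
  case (Suc N)
  let ?g = "fps_const (geometric (a (Suc N)))" and ?l = "log_deriv_factor (a (Suc N))"
  have "fps_deriv (gen_series a (Suc N)) = gen_series a N * ?g
      + fps_deriv (gen_series a N) * (1 + fps_X * ?g)"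
    by (simp add: gen_series_Suc)
  also have "\<dots> = gen_series a N * (?l * (1 + fps_X * ?g))
      + (\<Sum>n=1..N. log_deriv_factor (a n)) * gen_series a N * (1 + fps_X * ?g)"
    by (simp only: log_deriv_factor_mult Suc)
  also have "\<dots> = (\<Sum>n=1..Suc N. log_deriv_factor (a n)) * gen_series a (Suc N)"
    by (simp add: gen_series_Suc algebra_simps)
  finally show ?case .
qed

text \<open>
  The equation \<open>fps_deriv_gen_series\<close> read off at $x^iy^j$. In this form it involves only finite
  sums and products, hence can be reduced modulo every prime and transported to $\mathcal{A}$.
\<close>
lemma comp_sum_recurrence:
  "of_nat (Suc j) * comp_sum a N (i + Suc j) (Suc j) =
     (\<Sum>b=0..j. \<Sum>c=0..i. (-1) ^ b * of_nat ((b + c) choose b) * (\<Sum>n=1..N. a n ^ Suc (b + c))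
        * comp_sum a N ((i - c) + (j - b)) (j - b))"
proof -
  have "fps_deriv (gen_series a N) $ j $ i
      = ((\<Sum>n=1..N. log_deriv_factor (a n)) * gen_series a N) $ j $ i"
    by (simp only: fps_deriv_gen_series)
  moreover have "fps_deriv (gen_series a N) $ j $ i = of_nat (Suc j) * comp_sum a N (i + Suc j) (Suc j)"
    unfolding fps_deriv_nth by (simp only: fps_of_nat[symmetric] fps_mult_left_const_nth gen_series_def
        fps_nth_Abs_fps Suc_eq_plus1)
  ultimately show ?thesis
    by (simp only: fps_mult_nth fps_sum_nth log_deriv_factor_nth gen_series_def
        fps_nth_Abs_fps sum_distrib_left)
qed

section \<open>The formal exponential and its differential equation\<close>

text \<open>
  The equation determines \<open>of_nat n * F $ n\<close> from the lower coefficients, and the positive integer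
  \<open>n\<close> is a unit in $\mathcal{A}$.
\<close>
lemma fps2_ode_unique:
  fixes F G H :: "ringA fps2"
  assumes "fps_deriv F = H * F" "fps_deriv G = H * G" "F $ 0 = G $ 0"
  shows "F = G"
proof (rule fps_ext)
  fix n
  show "F $ n = G $ n"
  proof (induction n rule: less_induct)
    case (less n)
    show ?case
    proof (cases n)
      case (Suc m)
      have "of_nat n * F $ n = (\<Sum>i=0..m. H $ i * F $ (m - i))"
        using assms(1)[THEN arg_cong[where f = "\<lambda>f. f $ m"]] Suc by (simp add: fps_mult_nth)
      also have "\<dots> = (\<Sum>i=0..m. H $ i * G $ (m - i))"
        by (intro sum.cong refl arg_cong2[where f = "(*)"] less) (simp add: Suc)
      also have "\<dots> = of_nat n * G $ n"
        using assms(2)[THEN arg_cong[where f = "\<lambda>f. f $ m"]] Suc by (simp add: fps_mult_nth)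
      finally have eq: "of_nat n * F $ n = of_nat n * G $ n" .
      have inv: "fps_const (inverse (of_nat n)) * of_nat n = (1 :: ringA fps)"
        using ringA_Rat_algebra[of n] Suc
        by (simp add: fps_of_nat[symmetric] mult.commute del: of_nat_Suc)
      have "F $ n = fps_const (inverse (of_nat n)) * of_nat n * F $ n"
        by (simp only: inv mult_1)
      also have "\<dots> = fps_const (inverse (of_nat n)) * of_nat n * G $ n"
        by (simp only: mult.assoc eq)
      also have "\<dots> = G $ n"
        by (simp only: inv mult_1)
      finally show ?thesis .
    qed (simp add: assms)
  qed
qed

lemma formal_sum_nth:
  assumes "finite J" "J \<subseteq> I" "\<And>n. n \<in> I \<Longrightarrow> n \<notin> J \<Longrightarrow> f n $ j $ i = 0"
  shows "formal_sum f I $ j $ i = (\<Sum>n\<in>J. f n $ j $ i)"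
  unfolding formal_sum_def fps_nth_Abs_fps
  by (rule sum.mono_neutral_left) (use assms in auto)

lemma inverse_fact_Suc:
  "inverse (of_nat (fact (Suc n)) :: ringA) * of_nat (Suc n) = inverse (of_nat (fact n))"
proof -
  have "of_nat (fact n) * (inverse (of_nat (fact (Suc n)) :: ringA) * of_nat (Suc n)) =
      of_nat (fact (Suc n)) * inverse (of_nat (fact (Suc n)))"
    by (simp only: fact_Suc of_nat_id of_nat_mult mult_ac)
  also have "\<dots> = 1" by (rule ringA_Rat_algebra) simp
  finally show ?thesis by (rule inverse_ringA_unique[symmetric])
qed

text \<open>
  When \<open>F\<close> is divisible by $y$, the power \<open>F ^ n\<close> does not reach the coefficient of $y^j$ for
  \<open>n > j\<close>, so that the exponential series can be truncated anywhere from \<open>j\<close> on.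
\<close>
lemma formal_exp_nth:
  fixes F :: "ringA fps2"
  assumes "F $ 0 = 0" "j \<le> m"
  shows "formal_exp F $ j = (\<Sum>n\<le>m. const2 (inverse (of_nat (fact n))) * F ^ n) $ j"
proof (rule fps_ext)
  fix i
  have "formal_exp F $ j $ i = (\<Sum>n\<le>m. (const2 (inverse (of_nat (fact n))) * F ^ n) $ j $ i)"
    unfolding formal_exp_def
    by (rule formal_sum_nth)
       (use assms startsby_zero_power_prefix[OF assms(1)] in \<open>auto simp: const2_def\<close>)
  then show "formal_exp F $ j $ i = (\<Sum>n\<le>m. const2 (inverse (of_nat (fact n))) * F ^ n) $ j $ i"
    by (simp only: fps_sum_nth)
qed

text \<open>
  Differentiating the exponential series truncated at \<open>Suc m\<close> gives \<open>fps_deriv F\<close> times the one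
  truncated at \<open>m\<close>, which is enough for the coefficient of $y^m$.
\<close>
lemma fps_deriv_formal_exp:
  fixes F :: "ringA fps2"
  assumes "F $ 0 = 0"
  shows "fps_deriv (formal_exp F) = fps_deriv F * formal_exp F"
proof (rule fps_ext)
  fix m
  let ?c = "\<lambda>n. const2 (inverse (of_nat (fact n))) :: ringA fps2"
  let ?T = "\<lambda>m. \<Sum>n\<le>m. ?c n * F ^ n"
  have "fps_deriv (?c (Suc n) * F ^ Suc n) = fps_deriv F * (?c n * F ^ n)" for n
  proof -
    have "?c (Suc n) * of_nat (Suc n) = ?c n"
      by (simp only: const2_def fps_of_nat[symmetric] fps_const_mult inverse_fact_Suc)
    moreover have "fps_deriv (?c (Suc n) * F ^ Suc n)
        = fps_deriv F * (?c (Suc n) * of_nat (Suc n) * F ^ n)"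
      unfolding const2_def fps_deriv_mult_const_left fps_deriv_power'
      by (simp only: diff_Suc_1 mult_ac)
    ultimately show ?thesis by simp
  qed
  then have deriv: "fps_deriv (?T (Suc m)) = fps_deriv F * ?T m"
    unfolding sum.atMost_Suc_shift fps_deriv_add fps_deriv_sum
    by (simp add: sum_distrib_left const2_def)
  have "fps_deriv (formal_exp F) $ m = fps_deriv (?T (Suc m)) $ m"
    unfolding fps_deriv_nth using formal_exp_nth[OF assms, of "m + 1" "Suc m"] by simp
  also have "\<dots> = (fps_deriv F * ?T m) $ m" by (simp only: deriv)
  also have "\<dots> = (fps_deriv F * formal_exp F) $ m"
    unfolding fps_mult_nth by (intro sum.cong refl) (simp add: formal_exp_nth[OF assms, of _ m])
  finally show "fps_deriv (formal_exp F) $ m = (fps_deriv F * formal_exp F) $ m" .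
qed

lemma inverse_1_ringA: "inverse (1::ringA) = 1"
  by (rule inverse_ringA_unique) simp

lemma formal_exp_nth_0:
  fixes F :: "ringA fps2"
  assumes "F $ 0 = 0"
  shows "formal_exp F $ 0 = 1"
  using formal_exp_nth[OF assms, of 0 0] by (simp add: const2_def inverse_1_ringA)

section \<open>The exponent of the generating function\<close>

lemma diff_power_nth:
  "(var_x - var_y :: 'a::comm_ring_1 fps2) ^ n $ j $ i =
     (if n = i + j then (-1) ^ j * of_nat (n choose j) else 0)"
proof -
  have "(var_x - var_y :: 'a fps2) ^ n = (- var_y + var_x) ^ n" by simp
  also have "\<dots> = (\<Sum>k\<le>n. of_nat (n choose k) * (- var_y) ^ k * var_x ^ (n - k))"
    by (rule binomial_ring)
  also have "\<dots> = (\<Sum>k\<le>n.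
      fps_const (fps_const (of_nat (n choose k) * (-1) ^ k) * fps_X ^ (n - k)) * fps_X ^ k)"
  proof (intro sum.cong refl)
    fix k
    have "(- var_y :: 'a fps2) ^ k = fps_const (fps_const ((-1) ^ k)) * fps_X ^ k"
    proof -
      have "- var_y = fps_const (fps_const (-1::'a)) * fps_X"
        by (simp add: var_y_def fps_eq_iff)
      then show ?thesis by (simp only: power_mult_distrib fps_const_power)
    qed
    then show "of_nat (n choose k) * (- var_y) ^ k * var_x ^ (n - k) =
       fps_const (fps_const (of_nat (n choose k) * (-1::'a) ^ k) * fps_X ^ (n - k)) * fps_X ^ k"
      by (simp only: var_x_def fps_const_power fps_of_nat[symmetric] fps_const_mult[symmetric] mult_ac)
  qed
  finally have "(var_x - var_y :: 'a fps2) ^ n $ j $ i = 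
     (\<Sum>k\<le>n. if j = k \<and> i = n - k then of_nat (n choose k) * (-1) ^ k else 0)"
    by (auto simp: fps_sum_nth intro!: sum.cong)
  also have "\<dots> = (\<Sum>k\<le>n.
      if j = k then (if i = n - j then of_nat (n choose j) * (-1) ^ j else 0) else 0)"
    by (intro sum.cong refl) auto
  also have "\<dots> = (if n = i + j then (-1) ^ j * of_nat (n choose j) else 0)"
    by (auto simp: sum.delta')
  finally show ?thesis .
qed

definition exponent :: "ringA fps2" where
  "exponent = formal_sum
     (\<lambda>n. const2 (zeta2 [n] / of_nat n) * (var_x ^ n - (var_x - var_y) ^ n)) {1..}"

lemma var_x_power_nth: "(var_x ^ n :: 'a::comm_ring_1 fps2) $ j $ i = (if j = 0 \<and> i = n then 1 else 0)"
  by (simp add: var_x_def)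

text \<open>
  Both $x^n$ and $(x-y)^n$ are homogeneous of degree $n$, so that the coefficient of $x^iy^j$
  receives a contribution from $n=i+j$ only; the terms free of $y$ cancel.
\<close>
lemma exponent_nth:
  "exponent $ j $ i = (if j = 0 then 0
     else - (zeta2 [i + j] / of_nat (i + j)) * ((-1) ^ j * of_nat ((i + j) choose j)))"
proof (cases "i + j = 0")
  case True
  then show ?thesis using formal_sum_zeta2_const by (simp add: exponent_def)
next
  case False
  have "exponent $ j $ i = (\<Sum>n\<in>{i + j}.
      (const2 (zeta2 [n] / of_nat n) * (var_x ^ n - (var_x - var_y) ^ n)) $ j $ i)"
    unfolding exponent_def
    by (rule formal_sum_nth)
       (use False in \<open>auto simp: const2_def diff_power_nth var_x_power_nth\<close>)
  then show ?thesis
    by (simp add: const2_def diff_power_nth var_x_power_nth)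
qed

text \<open>
  The series $\sum_{m\ge1}\zeta_{\mathcal{A}}^{(2)}(m)(x-y)^{m-1}$, expanded in powers of $y$.
\<close>
definition zeta2_series :: "ringA fps2" where
  "zeta2_series = Abs_fps (\<lambda>b. Abs_fps (\<lambda>c. (-1) ^ b * of_nat ((b + c) choose b) * zeta2 [Suc (b + c)]))"

text \<open>
  Termwise, $\partial_y\,\bigl(x^m-(x-y)^m\bigr)/m=(x-y)^{m-1}$; on binomial coefficients this is the
  absorption identity $(b+1)\binom{m}{b+1}=m\binom{m-1}{b}$.
\<close>
lemma fps_deriv_exponent: "fps_deriv exponent = zeta2_series"
proof (intro fps_ext)
  fix b c
  let ?m = "Suc (b + c)" and ?z = "zeta2 [Suc (b + c)]"
  have "fps_deriv exponent $ b $ c = of_nat (Suc b) * exponent $ Suc b $ c"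
    unfolding fps_deriv_nth by (simp only: fps_of_nat[symmetric] fps_mult_left_const_nth Suc_eq_plus1)
  also have "\<dots> = (-1) ^ b * ?z * inverse (of_nat ?m) * of_nat (Suc b * (?m choose Suc b))"
  proof -
    have "exponent $ Suc b $ c = (-1) ^ b * ?z * inverse (of_nat ?m) * of_nat (?m choose Suc b)"
      by (simp add: exponent_nth divide_ringA_def add.commute[of c] mult_ac del: of_nat_Suc binomial_Suc_Suc)
    then show ?thesis by (simp only: of_nat_mult mult_ac)
  qed
  also have "\<dots> = (-1) ^ b * ?z * (of_nat ?m * inverse (of_nat ?m)) * of_nat ((b + c) choose b)"
    by (simp only: Suc_times_binomial of_nat_mult mult_ac)
  also have "\<dots> = zeta2_series $ b $ c"
    by (subst ringA_Rat_algebra) (simp_all add: zeta2_series_def mult_ac)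
  finally show "fps_deriv exponent $ b $ c = zeta2_series $ b $ c" .
qed

section \<open>From residues modulo $p$ to $\mathcal{A}$\<close>

lemma index_tuples_eq_increasing_tuples:
  assumes "p > 0"
  shows "index_tuples p r = increasing_tuples ((p - 1) div 2) r"
proof -
  have "real n < real p / 2 \<longleftrightarrow> n \<le> (p - 1) div 2" for n
    using assms by (simp add: field_simps) linarith
  then show ?thesis
    by (auto simp: index_tuples_def increasing_tuples_def)
qed

definition residue_inverse :: "nat \<Rightarrow> nat \<Rightarrow> int" where
  "residue_inverse p n = modular_inverse (int p) (int n)"

text \<open>The entries are less than \<open>p\<close>, hence units modulo \<open>p\<close>, where inversion is multiplicative.\<close>
lemma modular_inverse_prod_power:
  assumes "prime p" "ns \<in> increasing_tuples ((p - 1) div 2) r"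
  shows "[modular_inverse (int p) (\<Prod>i<r. int (ns ! i) ^ (ks ! i))
            = (\<Prod>i<r. residue_inverse p (ns ! i) ^ (ks ! i))] (mod int p)"
    (is "[modular_inverse _ ?x = ?y] (mod _)")
proof -
  have cop: "coprime (int (ns ! i)) (int p)" if "i < r" for i
  proof -
    have "ns ! i \<in> {0<..(p - 1) div 2}"
      using assms(2) that nth_mem by (fastforce simp: increasing_tuples_def)
    then have "0 < ns ! i" "ns ! i < p" by auto
    then have "\<not> p dvd ns ! i" using dvd_imp_le leD by blast
    then show ?thesis using assms(1) prime_imp_coprime[of p "ns ! i"]
      by (simp add: coprime_commute)
  qed
  have "[(\<Prod>i<r. (int (ns ! i) * residue_inverse p (ns ! i)) ^ (ks ! i))
      = (\<Prod>i<r. 1 ^ (ks ! i))] (mod int p)"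
    unfolding residue_inverse_def by (intro cong_prod cong_pow cong_modular_inverse1 cop) simp
  then have xy: "[?x * ?y = 1] (mod int p)"
    by (simp add: power_mult_distrib prod.distrib)
  have "coprime ?x (int p)"
    by (intro prod_coprime_left coprime_power_left_iff[THEN iffD2] disjI1 cop) simp
  then have x: "[modular_inverse (int p) ?x * ?x = 1] (mod int p)"
    by (rule cong_modular_inverse2)
  have "[modular_inverse (int p) ?x * 1 = modular_inverse (int p) ?x * (?x * ?y)] (mod int p)"
    by (intro cong_mult cong_refl cong_sym[OF xy])
  also have "modular_inverse (int p) ?x * (?x * ?y) = modular_inverse (int p) ?x * ?x * ?y"
    by (simp only: mult.assoc)
  also have "[modular_inverse (int p) ?x * ?x * ?y = 1 * ?y] (mod int p)"
    by (intro cong_mult cong_refl x)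
  finally show ?thesis by simp
qed

lemma of_family_cong:
  assumes "\<And>p. prime p \<Longrightarrow> [a p = b p] (mod int p)"
  shows "of_family a = of_family b"
proof -
  have "{p. prime p \<and> \<not> [a p = b p] (mod int p)} = {}" using assms by blast
  then show ?thesis unfolding of_family_eq_iff by (simp only: finite.emptyI)
qed

lemma of_family_sum: "of_family (\<lambda>p. \<Sum>i\<in>I. f i p) = (\<Sum>i\<in>I. of_family (f i))"
  by (induction I rule: infinite_finite_induct) (simp_all add: of_family_ring_ops(1,3))

lemma of_family_minus_one_power: "of_family (\<lambda>_. (-1) ^ b) = (-1) ^ b"
  by (induction b) (simp_all add: of_family_ring_ops(2,5))

lemma zeta2_eq_of_family:
  "zeta2 ks = of_family (\<lambda>p. \<Sum>ns\<in>increasing_tuples ((p - 1) div 2) (length ks).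
     \<Prod>i<length ks. residue_inverse p (ns ! i) ^ (ks ! i))"
  unfolding zeta2_def
  by (intro of_family_cong)
     (auto simp: index_tuples_eq_increasing_tuples prime_gt_0_nat intro!: cong_sum modular_inverse_prod_power)

lemma zeta2_singleton:
  "zeta2 [m] = of_family (\<lambda>p. \<Sum>n=1..(p - 1) div 2. residue_inverse p n ^ m)"
proof -
  have "increasing_tuples N (Suc 0) = (\<lambda>n. [n]) ` {1..N}" for N
    by (force simp: increasing_tuples_def length_Suc_conv)
  then show ?thesis
    unfolding zeta2_eq_of_family by (simp add: sum.reindex inj_on_def)
qed

lemma S_eq_of_family:
  "S k r = of_family (\<lambda>p. comp_sum (residue_inverse p) ((p - 1) div 2) k r)"
  unfolding S_def comp_sum_def of_family_sum zeta2_eq_of_family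
  by (intro sum.cong refl) (simp add: compositions_def of_family_sum)

text \<open>
  This is \<open>comp_sum_recurrence\<close> for the inverses modulo \<open>p\<close>, taken for all \<open>p\<close> at once: the map
  \<^const>\<open>of_family\<close> is additive and multiplicative, and the ranges of \<open>b\<close> and \<open>c\<close> do not depend
  on \<open>p\<close>.
\<close>
lemma S_recurrence:
  "of_nat (Suc j) * S (i + Suc j) (Suc j) =
     (\<Sum>b=0..j. \<Sum>c=0..i. (-1) ^ b * of_nat ((b + c) choose b) * zeta2 [Suc (b + c)]
        * S ((i - c) + (j - b)) (j - b))"
  unfolding S_eq_of_family zeta2_singleton of_family_of_nat[symmetric]
    of_family_minus_one_power[symmetric] of_family_ring_ops(6)[symmetric] of_family_sum[symmetric]
  by (simp only: comp_sum_recurrence)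

text \<open>
  The left-hand side of the identity (\<open>S_series_eq\<close>): since $S(0,0)=1$ and $S(i,0)=0$ for $i>0$, the
  row \<open>j = 0\<close> accounts for the summand $1$.
\<close>
definition S_series :: "ringA fps2" where
  "S_series = Abs_fps (\<lambda>j. Abs_fps (\<lambda>i. S (i + j) j))"

lemma fps_deriv_S_series: "fps_deriv S_series = zeta2_series * S_series"
proof (intro fps_ext)
  fix j i
  have "fps_deriv S_series $ j $ i = of_nat (Suc j) * S (i + Suc j) (Suc j)"
    unfolding fps_deriv_nth
    by (simp only: fps_of_nat[symmetric] fps_mult_left_const_nth S_series_def fps_nth_Abs_fps Suc_eq_plus1)
  then show "fps_deriv S_series $ j $ i = (zeta2_series * S_series) $ j $ i"
    by (simp only: S_recurrence fps_mult_nth fps_sum_nth zeta2_series_def S_series_def fps_nth_Abs_fps)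
qed

lemma S_0_right: "S k 0 = (if k = 0 then 1 else 0)"
  by (simp add: S_eq_of_family comp_sum_0_right of_family_ring_ops)

lemma S_series_eq:
  "S_series = 1 + formal_sum (\<lambda>(k, r). const2 (S k r) * var_x ^ (k - r) * var_y ^ r)
     {(k, r). k \<ge> r \<and> r \<ge> 1}"
proof (intro fps_ext)
  fix j i
  let ?t = "\<lambda>(k, r). const2 (S k r) * var_x ^ (k - r) * var_y ^ r :: ringA fps2"
  have coeff: "(const2 (S k r) * var_x ^ (k - r) * var_y ^ r) $ j $ i
      = (if j = r \<and> i = k - r then S k r else 0)" for k r j i
    by (simp add: const2_def var_x_def var_y_def fps_X_power_mult_right_nth)
  have "formal_sum ?t {(k, r). k \<ge> r \<and> r \<ge> 1} $ j $ i
      = (\<Sum>n\<in>(if j = 0 then {} else {(i + j, j)}). ?t n $ j $ i)"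
    by (rule formal_sum_nth) (auto simp: coeff simp del: fps_mult_nth_0 split: if_splits)
  also have "\<dots> = (if j = 0 then 0 else S (i + j) j)"
    using coeff[of "i + j" j j i] by (simp del: fps_mult_nth_0)
  finally show "S_series $ j $ i = (1 + formal_sum ?t {(k, r). k \<ge> r \<and> r \<ge> 1}) $ j $ i"
    by (simp add: S_series_def S_0_right)
qed

theorem corollary3p2:
  shows "1 + formal_sum (\<lambda>(k, r). const2 (S k r) * var_x ^ (k - r) * var_y ^ r)
               {(k, r). k \<ge> r \<and> r \<ge> 1}
       = formal_exp (formal_sum
           (\<lambda>n. const2 (zeta2 [n] / of_nat n) * (var_x ^ n - (var_x - var_y) ^ n)) {1..})"
proof -
  have E0: "exponent $ 0 = 0"
    by (rule fps_ext) (simp add: exponent_nth)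
  have "S_series = formal_exp exponent"
  proof (rule fps2_ode_unique[where H = zeta2_series])
    show "fps_deriv S_series = zeta2_series * S_series" by (rule fps_deriv_S_series)
    show "fps_deriv (formal_exp exponent) = zeta2_series * formal_exp exponent"
      by (simp only: fps_deriv_formal_exp[OF E0] fps_deriv_exponent)
    show "S_series $ 0 = formal_exp exponent $ 0"
      by (simp add: formal_exp_nth_0[OF E0] S_series_def S_0_right fps_eq_iff)
  qed
  then show ?thesis
    by (simp only: S_series_eq exponent_def)
qed

end
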